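(* Let $n\ge1$. Each of the following statistics on $S_n$ is homomesic for permutations with rotation, with the indicated average over every orbit of $rot$ on $S_n$ (items 5, 11 and 12 for $n\ge 2$; item 13 for $n\ge 3$): (1) the number of fixed points of a permutation (average $1$); (2) the number of excedances (average $\frac{n-1}{2}$); (3) the number of weak excedances (average $\frac{n+1}{2}$); (4) the number of indices that are not cyclical small excedances (average $n-1$); (5) the number of cyclical small weak excedances (average $2$); (6) the number of small excedances (average $\frac{n-1}{n}$); (7) the number of indices that are not small weak excedances (average $\frac{(n-1)^2}{n}$); (8) the number of small weak excedances (average $1+\frac{n-1}{n}$); (9) the number of indices that are not small excedances (average $n-\frac{n-1}{n}$); (10) the number of cyclical small excedances (average $1$); (11) the number of indices that are not cyclical small weak excedances (average $n-2$); (12) the number of $2$-excedances (average $\frac{n-2}{n}$); (13) the number of $3$-excedances (average $\frac{n-3}{n}$); (14) the size of the support of a permutation, i.e. the number of non-fixed points (average $n-1$); (15) the number of weak deficiencies (average $\frac{n+1}{2}$); (16) the number of deficiencies (average $\frac{n-1}{2}$); (17) the number of big deficiencies (average $\frac{(n-1)(n-2)}{2n}$); (18) the number of big excedances (average $\frac{(n-1)(n-2)}{2n}$); (19) the number of even weak deficiencies and odd weak excedances, i.e. the number of even indices $i$ with $\pi(i)\le i$ plus the number of odd indices $i$ with $\pi(i)\ge i$ (average $\lfloor\frac{n+2}{2}\rfloor$).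
   Context: $[n]=\{1,\dots,n\}$ and $S_n$ is the set of permutations of $[n]$, written in one-line notation $\pi=\pi(1)\pi(2)\cdots\pi(n)$. The rotation map $rot:S_n\to S_n$ sends $\pi(1)\pi(2)\cdots\pi(n)$ to $\pi(2)\cdots\pi(n)\pi(1)$. For a bijection $\varphi:S_n\to S_n$, the orbits are the sets $\{\varphi^m(\pi)\}$ of permutations obtained by applying $\varphi$ any number of times. A statistic $st$ is homomesic with average $c$ for $\varphi$ if $\frac{1}{\#\mathcal{O}}\sum_{x\in\mathcal{O}}st(x)=c$ for every orbit $\mathcal{O}$. An index $i\in[n]$ is, for $\pi\in S_n$: an excedance if $\pi(i)>i$; a deficiency if $\pi(i)<i$; a weak excedance if $\pi(i)\ge i$; a weak deficiency if $\pi(i)\le i$; a big excedance if $\pi(i)>i+1$; a big deficiency if $\pi(i)<i-1$; a $k$-excedance if $\pi(i)=i+k$; a fixed point if $\pi(i)=i$; a small excedance if $\pi(i)=i+1$; a small weak excedance if $\pi(i)\in\{i,i+1\}$; a cyclical small excedance if $\pi(i)\equiv i+1\pmod n$; a cyclical small weak excedance if $\pi(i)=i$ or $\pi(i)\equiv i+1\pmod n$. *)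

theory Defs
  imports Complex_Main "HOL-Combinatorics.Permutations" "HOL-Number_Theory.Cong"
begin

text \<open>
  A permutation of \<open>[n]\<close> is a function that permutes \<open>{1..n}\<close> and is the identity elsewhere.
\<close>

definition perms :: "nat \<Rightarrow> (nat \<Rightarrow> nat) set" where
  "perms n = {p. p permutes {1..n}}"

text \<open>Shifting the one-line word to the left; see \<open>rot_one_line\<close> below.\<close>

definition rot :: "nat \<Rightarrow> (nat \<Rightarrow> nat) \<Rightarrow> (nat \<Rightarrow> nat)" where
  "rot n p = (\<lambda>i. if i \<in> {1..n} then (if i = n then p 1 else p (i + 1)) else i)"

definition orbits_on :: "'a set \<Rightarrow> ('a \<Rightarrow> 'a) \<Rightarrow> 'a set set" where
  "orbits_on S \<phi> = {{(\<phi> ^^ m) x | m. True} | x. x \<in> S}"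

text \<open>Only meant for a bijection \<open>\<phi>\<close> of a finite set \<open>S\<close>.\<close>

definition homomesic :: "'a set \<Rightarrow> ('a \<Rightarrow> 'a) \<Rightarrow> ('a \<Rightarrow> nat) \<Rightarrow> real \<Rightarrow> bool" where
  "homomesic S \<phi> st c \<longleftrightarrow>
     (\<forall>B \<in> orbits_on S \<phi>. (1 / real (card B)) * (\<Sum>x\<in>B. real (st x)) = c)"

definition excedance :: "(nat \<Rightarrow> nat) \<Rightarrow> nat \<Rightarrow> bool" where
  "excedance p i \<longleftrightarrow> p i > i"

definition deficiency :: "(nat \<Rightarrow> nat) \<Rightarrow> nat \<Rightarrow> bool" where
  "deficiency p i \<longleftrightarrow> p i < i"

definition weak_excedance :: "(nat \<Rightarrow> nat) \<Rightarrow> nat \<Rightarrow> bool" where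
  "weak_excedance p i \<longleftrightarrow> p i \<ge> i"

definition weak_deficiency :: "(nat \<Rightarrow> nat) \<Rightarrow> nat \<Rightarrow> bool" where
  "weak_deficiency p i \<longleftrightarrow> p i \<le> i"

definition big_excedance :: "(nat \<Rightarrow> nat) \<Rightarrow> nat \<Rightarrow> bool" where
  "big_excedance p i \<longleftrightarrow> p i > i + 1"

definition big_deficiency :: "(nat \<Rightarrow> nat) \<Rightarrow> nat \<Rightarrow> bool" where
  "big_deficiency p i \<longleftrightarrow> int (p i) < int i - 1"

definition k_excedance :: "nat \<Rightarrow> (nat \<Rightarrow> nat) \<Rightarrow> nat \<Rightarrow> bool" where
  "k_excedance k p i \<longleftrightarrow> p i = i + k"

definition fixed_pt :: "(nat \<Rightarrow> nat) \<Rightarrow> nat \<Rightarrow> bool" where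
  "fixed_pt p i \<longleftrightarrow> p i = i"

definition small_excedance :: "(nat \<Rightarrow> nat) \<Rightarrow> nat \<Rightarrow> bool" where
  "small_excedance p i \<longleftrightarrow> p i = i + 1"

definition small_weak_excedance :: "(nat \<Rightarrow> nat) \<Rightarrow> nat \<Rightarrow> bool" where
  "small_weak_excedance p i \<longleftrightarrow> p i \<in> {i, i + 1}"

definition cyc_small_excedance :: "nat \<Rightarrow> (nat \<Rightarrow> nat) \<Rightarrow> nat \<Rightarrow> bool" where
  "cyc_small_excedance n p i \<longleftrightarrow> [p i = i + 1] (mod n)"

definition cyc_small_weak_excedance :: "nat \<Rightarrow> (nat \<Rightarrow> nat) \<Rightarrow> nat \<Rightarrow> bool" where
  "cyc_small_weak_excedance n p i \<longleftrightarrow> p i = i \<or> [p i = i + 1] (mod n)"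

definition num_indices :: "nat \<Rightarrow> (nat \<Rightarrow> bool) \<Rightarrow> nat" where
  "num_indices n P = card {i \<in> {1..n}. P i}"

lemma rot_one_line: "map (rot n p) [1..<n + 1] = rotate1 (map p [1..<n + 1])"
proof (cases n)
  case (Suc m)
  then show ?thesis
    by (intro nth_equalityI) (auto simp: rot_def nth_rotate1 simp del: upt_Suc)
qed simp

lemma rot_bij: "bij_betw (rot n) (perms n) (perms n)"
proof -
  have inj: "inj_on (rot n) (perms n)"
  proof (rule inj_onI)
    fix p q assume p: "p \<in> perms n" and q: "q \<in> perms n" and eq: "rot n p = rot n q"
    have "rotate1 (map p [1..<n + 1]) = rotate1 (map q [1..<n + 1])"
      using eq by (metis rot_one_line)
    then have "map p [1..<n + 1] = map q [1..<n + 1]"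
      by (rule injD[OF inj_rotate1])
    then have "p i = q i" if "i \<in> {1..n}" for i
      using that by (auto simp: map_eq_conv simp del: upt_Suc)
    moreover have "p i = q i" if "i \<notin> {1..n}" for i
      using p q that unfolding perms_def by (metis mem_Collect_eq permutes_not_in)
    ultimately show "p = q" by (intro ext) metis
  qed
  have maps: "rot n p \<in> perms n" if "p \<in> perms n" for p
  proof -
    have p: "p permutes {1..n}" using that by (simp add: perms_def)
    have set_upt: "set [1..<n + 1] = {1..n}" by auto
    have "rot n p ` {1..n} = set (map (rot n p) [1..<n + 1])"
      by (simp only: set_map set_upt)
    also have "\<dots> = p ` {1..n}"
      by (simp only: rot_one_line set_rotate1 set_map set_upt)
    also have "\<dots> = {1..n}" using p by (rule permutes_image)
    finally have im: "rot n p ` {1..n} = {1..n}" .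
    then have "bij_betw (rot n p) {1..n} {1..n}"
      by (simp add: bij_betw_def eq_card_imp_inj_on)
    then show ?thesis
      unfolding perms_def by (auto intro!: bij_imp_permutes simp: rot_def)
  qed
  have "finite (perms n)" by (simp add: perms_def finite_permutations)
  then show ?thesis
    using inj maps unfolding bij_betw_def by (metis endo_inj_surj image_subsetI)
qed

end

theory Submission
  imports Defs
begin

text \<open>
  Every statistic in the list counts the indices \<open>i\<close> for which a fixed relation \<open>R i (p i)\<close> holds,
  that is, the points of the graph of \<open>p\<close> lying in a fixed region \<open>R\<close> of the grid
  \<open>[n] \<times> [n]\<close>.  Rotation moves the graph one column to the left, cyclically, so that along the
  \<open>n\<close> successive rotations of \<open>p\<close> the entry in column \<open>i\<close> runs once through all the values of \<open>p\<close>,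
  which are the elements of \<open>[n]\<close>.  Hence each cell of the grid is met exactly once.  The \<open>n\<close>
  rotations are distinct and form the orbit, so the average over any orbit is the number of cells
  in \<open>R\<close> divided by \<open>n\<close>, independently of the orbit (\<open>homomesic_if_cell_count\<close>).

  What remains is to count cells: diagonals \<open>j = i + k\<close>, the triangles \<open>j > i + k\<close> above them,
  cyclic diagonals, the complements, disjoint unions and transposes of these regions, and for the
  last statistic the region that lies alternately above and below the diagonal.
\<close>

section \<open>Orbits of rotation\<close>

lemma rot_funpow_apply:
  assumes "i \<in> {1..n}"
  shows "(rot n ^^ m) p i = p ((i - 1 + m) mod n + 1)"
  using assms
proof (induction m arbitrary: i)
  case 0
  then have "(i - 1) mod n = i - 1" by (auto intro!: mod_less)
  then show ?case using 0 by simp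
next
  case (Suc m)
  show ?case
  proof (cases "i = n")
    case True
    have "n - 1 + Suc m = n + m" using Suc.prems by simp
    then have "(n - 1 + Suc m) mod n = m mod n" by (metis mod_add_self1)
    then show ?thesis using Suc.IH[of 1] Suc.prems True by (simp add: rot_def)
  next
    case False
    then show ?thesis using Suc.IH[of "i + 1"] Suc.prems by (simp add: rot_def)
  qed
qed

lemma rot_funpow_outside: "i \<notin> {1..n} \<Longrightarrow> p i = i \<Longrightarrow> (rot n ^^ m) p i = i"
  by (induction m) (auto simp: rot_def)

lemma bij_betw_cyclic_shift:
  fixes n a :: nat
  shows "bij_betw (\<lambda>m. (a + m) mod n + 1) {..<n} {1..n}"
proof -
  have inj: "inj_on (\<lambda>m. (a + m) mod n + 1) {..<n}"
  proof (rule inj_onI)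
    fix x y assume xy: "x \<in> {..<n}" "y \<in> {..<n}" "(a + x) mod n + 1 = (a + y) mod n + 1"
    then have "[a + x = a + y] (mod n)" by (simp add: cong_def)
    then have "[x = y] (mod n)" by (simp add: cong_add_lcancel_nat)
    then show "x = y" using xy by (simp add: cong_def)
  qed
  moreover have "(\<lambda>m. (a + m) mod n + 1) ` {..<n} \<subseteq> {1..n}"
    by (auto simp: Suc_le_eq intro!: mod_less_divisor)
  ultimately show ?thesis
    by (simp add: bij_betw_def card_image card_subset_eq)
qed

lemma rot_funpow_period:
  assumes "p \<in> perms n"
  shows "(rot n ^^ (m mod n)) p = (rot n ^^ m) p"
proof
  fix i
  show "(rot n ^^ (m mod n)) p i = (rot n ^^ m) p i"
  proof (cases "i \<in> {1..n}")
    case True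
    then show ?thesis by (simp only: rot_funpow_apply mod_add_right_eq)
  next
    case False
    then have "p i = i" using assms by (simp add: perms_def permutes_not_in)
    then show ?thesis using rot_funpow_outside[of i n p] False by metis
  qed
qed

text \<open>
  No two of the first \<open>n\<close> rotations agree, since their first letters are the \<open>n\<close> different letters
  of \<open>p\<close>.
\<close>

lemma rot_orbit:
  assumes "n \<ge> 1" and p: "p \<in> perms n"
  shows "{(rot n ^^ m) p | m. True} = (\<lambda>m. (rot n ^^ m) p) ` {..<n}"
    and "inj_on (\<lambda>m. (rot n ^^ m) p) {..<n}"
proof -
  have "(rot n ^^ m) p \<in> (\<lambda>m. (rot n ^^ m) p) ` {..<n}" for m
    using assms by (intro image_eqI[of _ _ "m mod n"]) (simp_all add: rot_funpow_period)
  then show "{(rot n ^^ m) p | m. True} = (\<lambda>m. (rot n ^^ m) p) ` {..<n}" by blast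
  have "inj p" using p by (simp add: perms_def permutes_inj)
  show "inj_on (\<lambda>m. (rot n ^^ m) p) {..<n}"
  proof (rule inj_onI)
    fix x y assume xy: "x \<in> {..<n}" "y \<in> {..<n}" "(rot n ^^ x) p = (rot n ^^ y) p"
    then have "p (x mod n + 1) = p (y mod n + 1)"
      using rot_funpow_apply[of 1 n x p] rot_funpow_apply[of 1 n y p] \<open>n \<ge> 1\<close> by simp
    then show "x = y" using \<open>inj p\<close> xy by (simp add: inj_eq)
  qed
qed

lemma sum_rotations_at_index:
  fixes f :: "nat \<Rightarrow> 'a::comm_monoid_add"
  assumes "p \<in> perms n" and i: "i \<in> {1..n}"
  shows "(\<Sum>m<n. f ((rot n ^^ m) p i)) = (\<Sum>j\<in>{1..n}. f j)"
proof -
  have "(\<Sum>m<n. f ((rot n ^^ m) p i)) = (\<Sum>m<n. f (p ((i - 1 + m) mod n + 1)))"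
    by (simp only: rot_funpow_apply[OF i])
  also have "\<dots> = (\<Sum>k\<in>{1..n}. f (p k))"
    by (rule sum.reindex_bij_betw[OF bij_betw_cyclic_shift])
  also have "\<dots> = (\<Sum>j\<in>{1..n}. f j)"
    using assms by (intro sum.reindex_bij_betw) (simp add: perms_def permutes_imp_bij)
  finally show ?thesis .
qed

section \<open>Orbit averages as cell counts\<close>

definition cells :: "nat \<Rightarrow> (nat \<Rightarrow> nat \<Rightarrow> bool) \<Rightarrow> nat" where
  "cells n R = card {(i, j) \<in> {1..n} \<times> {1..n}. R i j}"

lemma cells_eq_sum: "cells n R = (\<Sum>i\<in>{1..n}. card {j \<in> {1..n}. R i j})"
proof -
  have "{(i, j) \<in> {1..n} \<times> {1..n}. R i j} = (SIGMA i:{1..n}. {j \<in> {1..n}. R i j})" by auto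
  then show ?thesis by (simp add: cells_def)
qed

text \<open>
  Exchange the sum over the rotations with the sum over the indices: by
  \<open>sum_rotations_at_index\<close>, column \<open>i\<close> contributes the number of its cells that lie in \<open>R\<close>.
\<close>

lemma homomesic_if_cell_count:
  assumes "n \<ge> 1"
    and st: "\<And>p. p \<in> perms n \<Longrightarrow> st p = num_indices n (\<lambda>i. R i (p i))"
    and c: "real (cells n R) = c * real n"
  shows "homomesic (perms n) (rot n) st c"
  unfolding homomesic_def
proof
  fix B assume "B \<in> orbits_on (perms n) (rot n)"
  then obtain p where p: "p \<in> perms n" and "B = {(rot n ^^ m) p | m. True}"
    by (auto simp: orbits_on_def)
  then have B: "B = (\<lambda>m. (rot n ^^ m) p) ` {..<n}"
    and inj: "inj_on (\<lambda>m. (rot n ^^ m) p) {..<n}"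
    using rot_orbit[OF \<open>n \<ge> 1\<close> p] by auto
  have rotp: "(rot n ^^ m) p \<in> perms n" for m
    using p by (induction m) (auto intro: bij_betw_apply[OF rot_bij])
  have card_row: "card {k \<in> {1..n}. P k} = (\<Sum>k\<in>{1..n}. if P k then 1 else 0)" for P
    by (simp flip: sum.inter_filter)
  have "(\<Sum>x\<in>B. st x) = (\<Sum>m<n. st ((rot n ^^ m) p))"
    unfolding B by (simp add: sum.reindex[OF inj])
  also have "\<dots> = (\<Sum>m<n. \<Sum>i\<in>{1..n}. if R i ((rot n ^^ m) p i) then 1 else 0)"
    by (simp only: st[OF rotp] num_indices_def card_row)
  also have "\<dots> = (\<Sum>i\<in>{1..n}. \<Sum>m<n. if R i ((rot n ^^ m) p i) then 1 else 0)"
    by (rule sum.swap)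
  also have "\<dots> = (\<Sum>i\<in>{1..n}. \<Sum>j\<in>{1..n}. if R i j then 1 else 0)"
  proof (rule sum.cong[OF refl])
    fix i assume "i \<in> {1..n}"
    then show "(\<Sum>m<n. if R i ((rot n ^^ m) p i) then 1 else 0) = (\<Sum>j\<in>{1..n}. if R i j then 1 else 0)"
      by (rule sum_rotations_at_index[OF p, where f = "\<lambda>j. if R i j then 1 else 0"])
  qed
  also have "\<dots> = cells n R"
    by (simp only: cells_eq_sum card_row)
  finally have "(\<Sum>x\<in>B. real (st x)) = c * real n"
    using c by (metis of_nat_sum)
  moreover have "card B = n"
    unfolding B by (simp add: card_image[OF inj])
  ultimately show "(1 / real (card B)) * (\<Sum>x\<in>B. real (st x)) = c"
    using \<open>n \<ge> 1\<close> by simp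
qed

section \<open>Counting cells\<close>

lemma finite_region: "finite {(i, j) \<in> {1..n} \<times> {1..n::nat}. R i j}"
  by (rule finite_subset[of _ "{1..n} \<times> {1..n}"]) auto

lemma cells_disj:
  assumes "\<And>i j. i \<in> {1..n} \<Longrightarrow> j \<in> {1..n} \<Longrightarrow> \<not> (R i j \<and> S i j)"
  shows "cells n (\<lambda>i j. R i j \<or> S i j) = cells n R + cells n S"
proof -
  have *: "{(i, j) \<in> {1..n} \<times> {1..n}. R i j \<or> S i j} =
      {(i, j) \<in> {1..n} \<times> {1..n}. R i j} \<union> {(i, j) \<in> {1..n} \<times> {1..n}. S i j}" by auto
  show ?thesis
    unfolding cells_def * by (intro card_Un_disjoint finite_region) (use assms in auto)
qed

lemma cells_not: "real (cells n (\<lambda>i j. \<not> R i j)) = (real n)\<^sup>2 - real (cells n R)"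
proof -
  have "cells n R + cells n (\<lambda>i j. \<not> R i j) = cells n (\<lambda>i j. R i j \<or> \<not> R i j)"
    by (rule cells_disj[symmetric]) auto
  also have "\<dots> = n * n" by (simp add: cells_eq_sum del: atLeastAtMost_iff)
  finally have "real (cells n R) + real (cells n (\<lambda>i j. \<not> R i j)) = real n * real n"
    by (metis of_nat_add of_nat_mult)
  then show ?thesis by (simp add: power2_eq_square)
qed

lemma cells_transpose: "cells n (\<lambda>i j. R j i) = cells n R"
  unfolding cells_def by (rule bij_betw_same_card[of prod.swap])
    (auto simp: bij_betw_def inj_on_def image_iff)

lemma cells_diagonal:
  assumes "k \<le> n"
  shows "real (cells n (\<lambda>i j. j = i + k)) = real n - real k"
proof -
  have "{(i, j) \<in> {1..n} \<times> {1..n}. j = i + k} = (\<lambda>i. (i, i + k)) ` {1..n - k}" by auto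
  then have "cells n (\<lambda>i j. j = i + k) = n - k"
    unfolding cells_def by (simp add: card_image inj_on_def)
  then show ?thesis using assms by simp
qed

lemma cells_above_diagonal:
  assumes "k \<le> n"
  shows "real (cells n (\<lambda>i j. i + k < j)) = (real n - real k) * (real n - real k - 1) / 2"
  using assms
proof (induction n rule: dec_induct)
  case base
  have "{(i, j) \<in> {1..k} \<times> {1..k}. i + k < j} = {}" by auto
  then show ?case unfolding cells_def by (simp only:) simp
next
  case (step n)
  \<comment> \<open>Enlarging the grid adds the cells with \<open>j = n + 1\<close>, of which those with \<open>i \<le> n - k\<close> count;
    the new column \<open>i = n + 1\<close> adds nothing.\<close>
  have *: "{(i, j) \<in> {1..Suc n} \<times> {1..Suc n}. i + k < j} =
      {(i, j) \<in> {1..n} \<times> {1..n}. i + k < j} \<union> (\<lambda>i. (i, Suc n)) ` {1..n - k}"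
    using step.hyps by (auto simp: image_iff)
  have "cells (Suc n) (\<lambda>i j. i + k < j) =
      cells n (\<lambda>i j. i + k < j) + card ((\<lambda>i. (i, Suc n)) ` {1..n - k})"
    unfolding cells_def * by (intro card_Un_disjoint finite_region) auto
  also have "card ((\<lambda>i. (i, Suc n)) ` {1..n - k}) = n - k"
    by (simp add: card_image inj_on_def)
  finally have "cells (Suc n) (\<lambda>i j. i + k < j) = cells n (\<lambda>i j. i + k < j) + (n - k)" .
  then show ?case
    using step by (simp add: of_nat_diff field_simps)
qed

lemma cells_cyclic_diagonal: "cells n (\<lambda>i j. [j = i + 1] (mod n)) = n"
proof -
  have "{j \<in> {1..n}. [j = i + 1] (mod n)} = {i mod n + 1}" if "i \<in> {1..n}" for i
  proof -
    have "[j = i + 1] (mod n) \<longleftrightarrow> j = i mod n + 1" if "j \<in> {1..n}" for j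
    proof -
      define k where "k = j - 1"
      have k: "j = k + 1" "k < n" using that unfolding k_def by auto
      then have "[j = i + 1] (mod n) \<longleftrightarrow> [k = i] (mod n)" by (simp only: cong_add_rcancel_nat)
      then show ?thesis using k by (simp add: cong_def)
    qed
    moreover have "i mod n + 1 \<in> {1..n}" using that by (auto simp: Suc_le_eq)
    ultimately show ?thesis by auto
  qed
  then show ?thesis by (simp add: cells_eq_sum)
qed

text \<open>
  Consecutive columns \<open>2 t - 1\<close> and \<open>2 t\<close> contain \<open>(n + 2 - 2 t) + 2 t = n + 2\<close> cells together; for
  odd \<open>n\<close> the unpaired column \<open>n\<close> adds a single one.
\<close>

lemma cells_alternating:
  "cells n (\<lambda>i j. (even i \<and> j \<le> i) \<or> (odd i \<and> i \<le> j)) = n * ((n + 2) div 2)"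
proof -
  let ?h = "\<lambda>i. if even i then i else n + 1 - i"
  have "card {j \<in> {1..n}. (even i \<and> j \<le> i) \<or> (odd i \<and> i \<le> j)} = ?h i" if "i \<in> {1..n}" for i
  proof (cases "even i")
    case True
    then have "{j \<in> {1..n}. (even i \<and> j \<le> i) \<or> (odd i \<and> i \<le> j)} = {1..i}" using that by auto
    then show ?thesis using True by simp
  next
    case False
    then have "{j \<in> {1..n}. (even i \<and> j \<le> i) \<or> (odd i \<and> i \<le> j)} = {i..n}" using that by auto
    then show ?thesis using False by simp
  qed
  then have *: "cells n (\<lambda>i j. (even i \<and> j \<le> i) \<or> (odd i \<and> i \<le> j)) = (\<Sum>i\<in>{1..n}. ?h i)"
    by (simp add: cells_eq_sum)
  have pairs: "(\<Sum>i\<in>{1..2 * k}. ?h i) = k * (n + 2)" if "2 * k \<le> n" for k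
    using that by (induction k) auto
  show ?thesis
  proof (cases "even n")
    case True
    then obtain k where k: "n = 2 * k" by (auto elim: evenE)
    show ?thesis unfolding * using pairs[of k] k by simp
  next
    case False
    then obtain k where k: "n = Suc (2 * k)" by (auto elim: oddE)
    have "(\<Sum>i\<in>{1..n}. ?h i) = k * (n + 2) + 1"
      using pairs[of k] k by simp
    then show ?thesis unfolding * using k by (simp add: algebra_simps)
  qed
qed

section \<open>The homomesic statistics\<close>

theorem theorem2p3:
  fixes n :: nat
  assumes "n \<ge> 1"
  shows
   "homomesic (perms n) (rot n) (\<lambda>p. num_indices n (\<lambda>i. fixed_pt p i)) 1 \<and>
    homomesic (perms n) (rot n) (\<lambda>p. num_indices n (\<lambda>i. excedance p i)) ((real n - 1) / 2) \<and>
    homomesic (perms n) (rot n) (\<lambda>p. num_indices n (\<lambda>i. weak_excedance p i)) ((real n + 1) / 2) \<and>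
    homomesic (perms n) (rot n) (\<lambda>p. num_indices n (\<lambda>i. \<not> cyc_small_excedance n p i)) (real n - 1) \<and>
    (n \<ge> 2 \<longrightarrow>
      homomesic (perms n) (rot n) (\<lambda>p. num_indices n (\<lambda>i. cyc_small_weak_excedance n p i)) 2) \<and>
    homomesic (perms n) (rot n) (\<lambda>p. num_indices n (\<lambda>i. small_excedance p i))
      ((real n - 1) / real n) \<and>
    homomesic (perms n) (rot n) (\<lambda>p. num_indices n (\<lambda>i. \<not> small_weak_excedance p i))
      ((real n - 1)\<^sup>2 / real n) \<and>
    homomesic (perms n) (rot n) (\<lambda>p. num_indices n (\<lambda>i. small_weak_excedance p i))
      (1 + (real n - 1) / real n) \<and>
    homomesic (perms n) (rot n) (\<lambda>p. num_indices n (\<lambda>i. \<not> small_excedance p i))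
      (real n - (real n - 1) / real n) \<and>
    homomesic (perms n) (rot n) (\<lambda>p. num_indices n (\<lambda>i. cyc_small_excedance n p i)) 1 \<and>
    (n \<ge> 2 \<longrightarrow>
      homomesic (perms n) (rot n) (\<lambda>p. num_indices n (\<lambda>i. \<not> cyc_small_weak_excedance n p i))
        (real n - 2)) \<and>
    (n \<ge> 2 \<longrightarrow>
      homomesic (perms n) (rot n) (\<lambda>p. num_indices n (\<lambda>i. k_excedance 2 p i))
        ((real n - 2) / real n)) \<and>
    (n \<ge> 3 \<longrightarrow>
      homomesic (perms n) (rot n) (\<lambda>p. num_indices n (\<lambda>i. k_excedance 3 p i))
        ((real n - 3) / real n)) \<and>
    homomesic (perms n) (rot n) (\<lambda>p. num_indices n (\<lambda>i. \<not> fixed_pt p i)) (real n - 1) \<and>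
    homomesic (perms n) (rot n) (\<lambda>p. num_indices n (\<lambda>i. weak_deficiency p i)) ((real n + 1) / 2) \<and>
    homomesic (perms n) (rot n) (\<lambda>p. num_indices n (\<lambda>i. deficiency p i)) ((real n - 1) / 2) \<and>
    homomesic (perms n) (rot n) (\<lambda>p. num_indices n (\<lambda>i. big_deficiency p i))
      ((real n - 1) * (real n - 2) / (2 * real n)) \<and>
    homomesic (perms n) (rot n) (\<lambda>p. num_indices n (\<lambda>i. big_excedance p i))
      ((real n - 1) * (real n - 2) / (2 * real n)) \<and>
    homomesic (perms n) (rot n)
      (\<lambda>p. num_indices n (\<lambda>i. even i \<and> weak_deficiency p i)
          + num_indices n (\<lambda>i. odd i \<and> weak_excedance p i))
      (of_int \<lfloor>(real n + 2) / 2\<rfloor>)"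
proof -
  note homomesic = homomesic_if_cell_count[OF \<open>n \<ge> 1\<close> refl]
  note count_diag = cells_diagonal[OF le0, of n, simplified] cells_diagonal[OF \<open>n \<ge> 1\<close>]
  note count_tri = cells_above_diagonal[OF le0, of n, simplified] cells_above_diagonal[OF \<open>n \<ge> 1\<close>]
  have small_weak: "cells n (\<lambda>i j. j \<in> {i, i + 1}) = cells n (\<lambda>i j. j = i) + cells n (\<lambda>i j. j = i + 1)"
    using cells_disj[of n "\<lambda>i j. j = i" "\<lambda>i j. j = i + 1"] by simp
  \<comment> \<open>For \<open>n = 1\<close> every two numbers are congruent, and the union below would not be disjoint.\<close>
  have cyc_weak: "real (cells n (\<lambda>i j. j = i \<or> [j = i + 1] (mod n))) = 2 * real n" if "n \<ge> 2"
  proof -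
    have "\<not> [i = i + 1] (mod n)" for i
      using that cong_add_lcancel_0_nat[of i 1 n] by (simp add: cong_sym_eq[of i] cong_def)
    then have "cells n (\<lambda>i j. j = i \<or> [j = i + 1] (mod n)) =
        cells n (\<lambda>i j. j = i) + cells n (\<lambda>i j. [j = i + 1] (mod n))"
      by (intro cells_disj) auto
    then show ?thesis using count_diag cells_cyclic_diagonal[of n] by simp
  qed
  have "int j < int i - 1 \<longleftrightarrow> j + 1 < i" for i j by linarith
  then have big_defic: "real (cells n (\<lambda>i j. int j < int i - 1)) = (real n - 1) * (real n - 2) / 2"
    using count_tri(2) cells_transpose[of n "\<lambda>i j. i + 1 < j"] by simp
  have defic: "real (cells n (\<lambda>i j. j < i)) = real n * (real n - 1) / 2"
    using count_tri(1) cells_transpose[of n "\<lambda>i j. i < j"] by simp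
  have weak_exc: "real (cells n (\<lambda>i j. i \<le> j)) = real n * (real n + 1) / 2"
    using cells_not[of n "\<lambda>i j. j < i"] defic
    by (simp add: not_less power2_eq_square field_simps)
  have weak_defic: "real (cells n (\<lambda>i j. j \<le> i)) = real n * (real n + 1) / 2"
    using weak_exc cells_transpose[of n "\<lambda>i j. i \<le> j"] by simp
  have nz: "real n \<noteq> 0" using \<open>n \<ge> 1\<close> by simp
  have half: "\<lfloor>(real n + 2) / 2\<rfloor> = int ((n + 2) div 2)"
    using floor_divide_of_nat_eq[of "n + 2" 2, where ?'a = real] by (simp add: add.commute)
  \<comment> \<open>The last statistic is a sum of two counts over disjoint sets of indices, hence also the count
    for one region.\<close>
  have alternating: "num_indices n (\<lambda>i. even i \<and> p i \<le> i) + num_indices n (\<lambda>i. odd i \<and> i \<le> p i) =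
      num_indices n (\<lambda>i. (even i \<and> p i \<le> i) \<or> (odd i \<and> i \<le> p i))" for p
  proof -
    have "{i \<in> {1..n}. (even i \<and> p i \<le> i) \<or> (odd i \<and> i \<le> p i)} =
        {i \<in> {1..n}. even i \<and> p i \<le> i} \<union> {i \<in> {1..n}. odd i \<and> i \<le> p i}" by auto
    moreover have "card \<dots> = card {i \<in> {1..n}. even i \<and> p i \<le> i} + card {i \<in> {1..n}. odd i \<and> i \<le> p i}"
      by (rule card_Un_disjoint) auto
    ultimately show ?thesis unfolding num_indices_def by simp
  qed
  show ?thesis
    unfolding fixed_pt_def excedance_def weak_excedance_def cyc_small_excedance_def
      cyc_small_weak_excedance_def small_excedance_def small_weak_excedance_def k_excedance_def
      weak_deficiency_def deficiency_def big_deficiency_def big_excedance_def alternating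
  proof (intro conjI impI)
    show "homomesic (perms n) (rot n)
        (\<lambda>p. num_indices n (\<lambda>i. p i = i)) 1"
      by (rule homomesic[where R = "\<lambda>i j. j = i"])
        (use count_diag nz in simp)
  next
    show "homomesic (perms n) (rot n)
        (\<lambda>p. num_indices n (\<lambda>i. i < p i)) ((real n - 1) / 2)"
      by (rule homomesic[where R = "\<lambda>i j. i < j"])
        (use count_tri nz in simp)
  next
    show "homomesic (perms n) (rot n)
        (\<lambda>p. num_indices n (\<lambda>i. i \<le> p i)) ((real n + 1) / 2)"
      by (rule homomesic[where R = "\<lambda>i j. i \<le> j"])
        (use weak_exc in simp)
  next
    show "homomesic (perms n) (rot n)
        (\<lambda>p. num_indices n (\<lambda>i. \<not> [p i = i + 1] (mod n))) (real n - 1)"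
      by (rule homomesic[where R = "\<lambda>i j. \<not> [j = i + 1] (mod n)"])
        (simp only: cells_not cells_cyclic_diagonal, simp add: power2_eq_square algebra_simps)
  next
    assume n_ge: "n \<ge> 2"
    show "homomesic (perms n) (rot n)
        (\<lambda>p. num_indices n (\<lambda>i. p i = i \<or> [p i = i + 1] (mod n))) 2"
      by (rule homomesic[where R = "\<lambda>i j. j = i \<or> [j = i + 1] (mod n)"])
        (use cyc_weak n_ge in simp)
  next
    show "homomesic (perms n) (rot n)
        (\<lambda>p. num_indices n (\<lambda>i. p i = i + 1)) ((real n - 1) / real n)"
      by (rule homomesic[where R = "\<lambda>i j. j = i + 1"])
        (use count_diag nz in simp)
  next
    show "homomesic (perms n) (rot n)
        (\<lambda>p. num_indices n (\<lambda>i. p i \<notin> {i, i + 1})) ((real n - 1)\<^sup>2 / real n)"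
      by (rule homomesic[where R = "\<lambda>i j. j \<notin> {i, i + 1}"])
        (use count_diag nz in \<open>simp only: cells_not small_weak of_nat_add, simp add: power2_eq_square field_simps\<close>)
  next
    show "homomesic (perms n) (rot n)
        (\<lambda>p. num_indices n (\<lambda>i. p i \<in> {i, i + 1})) (1 + (real n - 1) / real n)"
      by (rule homomesic[where R = "\<lambda>i j. j \<in> {i, i + 1}"])
        (use count_diag nz in \<open>simp only: small_weak of_nat_add, simp add: field_simps\<close>)
  next
    show "homomesic (perms n) (rot n)
        (\<lambda>p. num_indices n (\<lambda>i. p i \<noteq> i + 1)) (real n - (real n - 1) / real n)"
      by (rule homomesic[where R = "\<lambda>i j. j \<noteq> i + 1"])
        (use count_diag nz in \<open>simp only: cells_not, simp add: power2_eq_square field_simps\<close>)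
  next
    show "homomesic (perms n) (rot n)
        (\<lambda>p. num_indices n (\<lambda>i. [p i = i + 1] (mod n))) 1"
      by (rule homomesic[where R = "\<lambda>i j. [j = i + 1] (mod n)"])
        (use cells_cyclic_diagonal in simp)
  next
    assume n_ge: "n \<ge> 2"
    show "homomesic (perms n) (rot n)
        (\<lambda>p. num_indices n (\<lambda>i. \<not> (p i = i \<or> [p i = i + 1] (mod n)))) (real n - 2)"
      by (rule homomesic[where R = "\<lambda>i j. \<not> (j = i \<or> [j = i + 1] (mod n))"])
        (use n_ge in \<open>simp only: cells_not cyc_weak, simp add: power2_eq_square algebra_simps\<close>)
  next
    assume n_ge: "n \<ge> 2"
    show "homomesic (perms n) (rot n)
        (\<lambda>p. num_indices n (\<lambda>i. p i = i + 2)) ((real n - 2) / real n)"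
      by (rule homomesic[where R = "\<lambda>i j. j = i + 2"])
        (use cells_diagonal[OF n_ge] nz in simp)
  next
    assume n_ge: "n \<ge> 3"
    show "homomesic (perms n) (rot n)
        (\<lambda>p. num_indices n (\<lambda>i. p i = i + 3)) ((real n - 3) / real n)"
      by (rule homomesic[where R = "\<lambda>i j. j = i + 3"])
        (use cells_diagonal[OF n_ge] nz in simp)
  next
    show "homomesic (perms n) (rot n)
        (\<lambda>p. num_indices n (\<lambda>i. p i \<noteq> i)) (real n - 1)"
      by (rule homomesic[where R = "\<lambda>i j. j \<noteq> i"])
        (use count_diag nz in \<open>simp only: cells_not, simp add: power2_eq_square algebra_simps\<close>)
  next
    show "homomesic (perms n) (rot n)
        (\<lambda>p. num_indices n (\<lambda>i. p i \<le> i)) ((real n + 1) / 2)"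
      by (rule homomesic[where R = "\<lambda>i j. j \<le> i"])
        (use weak_defic in simp)
  next
    show "homomesic (perms n) (rot n)
        (\<lambda>p. num_indices n (\<lambda>i. p i < i)) ((real n - 1) / 2)"
      by (rule homomesic[where R = "\<lambda>i j. j < i"])
        (use defic in simp)
  next
    show "homomesic (perms n) (rot n)
        (\<lambda>p. num_indices n (\<lambda>i. int (p i) < int i - 1)) ((real n - 1) * (real n - 2) / (2 * real n))"
      by (rule homomesic[where R = "\<lambda>i j. int j < int i - 1"])
        (use big_defic nz in simp)
  next
    show "homomesic (perms n) (rot n)
        (\<lambda>p. num_indices n (\<lambda>i. i + 1 < p i)) ((real n - 1) * (real n - 2) / (2 * real n))"
      by (rule homomesic[where R = "\<lambda>i j. i + 1 < j"])
        (use count_tri nz in simp)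
  next
    show "homomesic (perms n) (rot n)
        (\<lambda>p. num_indices n (\<lambda>i. (even i \<and> p i \<le> i) \<or> (odd i \<and> i \<le> p i))) (of_int \<lfloor>(real n + 2) / 2\<rfloor>)"
      by (rule homomesic[where R = "\<lambda>i j. (even i \<and> j \<le> i) \<or> (odd i \<and> i \<le> j)"])
        (simp only: cells_alternating half, simp add: algebra_simps)
  qed
qed

end
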